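(* Let $\{\mathcal F_d\}_{d\in\mathbb N\cup\{\infty\}}$ be a family of function classes, where each $\mathcal F_d$ consists of functions $\mathcal H_d\to\mathbb R$, let $\epsilon$ be an error metric and let $\bar p\in\mathbb N$. Suppose that this family satisfies the direct-sum assumption (A) and the nonasymptotic lower bound assumption (B) stated in the context, with $\beta:[1,\infty)\to(0,1]$ being the decreasing bijection from (B). Let $\rho:[1,\infty)\to(0,1]$ be a decreasing bijection. Then there exist a function $F\in\mathcal F_\infty$ and a sequence of positive integers $n_1,n_2,\dots$ with $\lim_{i\to\infty}n_i=\infty$ such that $$\inf_{\mathrm A\in\mathcal A_{\mathrm{zr}}^{(\bar p)}}\epsilon_{n_i}(\mathrm A,F)\ \ge\ \rho(n_i)\,\beta(n_i)\qquad\text{for all } i\in\mathbb N .$$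
   Context: $\mathbb N=\{1,2,\dots\}$. For $d\in\mathbb N$, $\mathcal H_d$ is a $d$-dimensional real Hilbert space, and $\mathcal H_\infty$ is an infinite-dimensional real Hilbert space with coordinates indexed by $\mathbb N$ (i.e. $\ell^2$); coordinates are with respect to a fixed orthonormal basis. Given positive integers $\{d_i\}_{i\ge1}$, $\mathcal H_\infty$ is identified with $\bigoplus_{i\ge1}\mathcal H_{d_i}=\{x=(\underline x_i)_{i\ge1}:\underline x_i\in\mathcal H_{d_i},\ \sum_i\|\underline x_i\|^2<\infty\}$ with inner product $\langle x,y\rangle=\sum_i\langle\underline x_i,\underline y_i\rangle$, by concatenating coordinates. Support: for a vector $x$, $\operatorname{supp}\{x\}=\{j:x_j\ne0\}$; for a symmetric order-$r$ tensor $T$, $r\ge2$, $\operatorname{supp}\{T\}=\{j: T_{j,j_2,\dots,j_r}\neq0\text{ for some }j_2,\dots,j_r\}$. Zero-respecting: for $f:\mathcal H\to\mathbb R$ differentiable through order $\bar p$, a sequence $x^{(1)},x^{(2)},\dots$ is $\bar p$th-order zero-respecting with respect to $f$ if for each $t\in\mathbb N$, $\operatorname{supp}\{x^{(t)}\}\subseteq\bigcup_{r\in\{1,\dots,\bar p\}}\bigcup_{s<t}\operatorname{supp}\{\nabla^rf(x^{(s)})\}$ (so $x^{(1)}=\mathbf 0$). An algorithm $\mathrm A$ maps an objective $f:\mathcal H\to\mathbb R$ to a sequence of iterates $\mathrm A[f]=\{x^{(t)}\}_{t\ge1}$ in $\mathcal H$; $\mathrm A\in\mathcal A_{\mathrm{zr}}^{(\bar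 p)}$ if for every $f$ differentiable through order $\bar p$ the sequence $\mathrm A[f]$ is $\bar p$th-order zero-respecting with respect to $f$. Error metric: $\epsilon(x,f)\ge0$ for every $x$ in the domain of $f$; $\epsilon_n(\mathrm A,f):=\epsilon(x^{(n+1)},f)$ where $\{x^{(t)}\}=\mathrm A[f]$. All functions in the classes $\mathcal F_d$ are differentiable through order $\bar p$. Assumption (A) (direct sums): there exist a nonnegative integer $q$ and positive real sequences $\{\lambda_i\}_{i\ge1}$, $\{\mu_i\}_{i\ge1}$ such that for any sequence of positive integers $\{d_i\}_{i\ge1}$ and any functions $f_i\in\mathcal F_{d_i}$, the function $F(x):=\sum_{i=1}^\infty\lambda_if_i(\mu_i\underline x_i)$, $x=(\underline x_i)_{i\ge1}\in\mathcal H_\infty$, belongs to $\mathcal F_\infty$, and for all $i\in\mathbb N$ and all $x\in\mathcal H_\infty$, $\epsilon(x,F)\ge\lambda_i\mu_i^q\,\epsilon(\mu_i\underline x_i,f_i)$. Assumption (B) (nonasymptotic lower bound): there exist a decreasing bijection $\beta:[1,\infty)\to(0,1]$ and a constant $C>0$ such that for every $n\in\mathbb N$ there exist $d_n\in\mathbb N$ and $f\in\mathcal F_{d_n}$ such that for every $\bar p$th-order zero-respecting sequence $\{x^{(t)}\}_{t\ge1}$ with respect to $f$ with $x^{(1)}=\mathbf 0$, $\epsilon(x^{(n+1)},f)\ge C\beta(n)$. *)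

theory Defs
  imports "HOL-Analysis.Analysis"
begin

section \<open>The coordinate Hilbert spaces\<close>

typedef ell2 = "{x :: nat \<Rightarrow> real. summable (\<lambda>j. (x j)\<^sup>2)}"
  morphisms coord Abs_ell2
  by (rule exI[of _ "\<lambda>_. 0"]) simp

setup_lifting type_definition_ell2

lemma ell2_summable_prod:
  fixes x y :: "nat \<Rightarrow> real"
  assumes "summable (\<lambda>j. (x j)\<^sup>2)" "summable (\<lambda>j. (y j)\<^sup>2)"
  shows "summable (\<lambda>j. x j * y j)"
proof (rule summable_comparison_test')
  show "summable (\<lambda>j. (x j)\<^sup>2 + (y j)\<^sup>2)"
    using assms by (rule summable_add)
next
  fix j :: nat
  have "2 * (\<bar>x j\<bar> * \<bar>y j\<bar>) \<le> (x j)\<^sup>2 + (y j)\<^sup>2"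
    using sum_squares_bound[of "\<bar>x j\<bar>" "\<bar>y j\<bar>"] by (simp add: mult.assoc)
  moreover have "0 \<le> \<bar>x j\<bar> * \<bar>y j\<bar>" by simp
  ultimately show "norm (x j * y j) \<le> (x j)\<^sup>2 + (y j)\<^sup>2"
    unfolding real_norm_def abs_mult by linarith
qed

lemma ell2_summable_add:
  fixes x y :: "nat \<Rightarrow> real"
  assumes "summable (\<lambda>j. (x j)\<^sup>2)" "summable (\<lambda>j. (y j)\<^sup>2)"
  shows "summable (\<lambda>j. (x j + y j)\<^sup>2)"
proof -
  have "summable (\<lambda>j. ((x j)\<^sup>2 + (y j)\<^sup>2) + 2 * (x j * y j))"
    by (intro summable_add summable_mult ell2_summable_prod assms)
  then show ?thesis by (simp add: power2_sum mult.assoc)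
qed

lemma ell2_summable_scale:
  fixes x :: "nat \<Rightarrow> real"
  assumes "summable (\<lambda>j. (x j)\<^sup>2)"
  shows "summable (\<lambda>j. (c * x j)\<^sup>2)"
  using summable_mult[OF assms, of "c\<^sup>2"] by (simp add: power_mult_distrib)

lemma ell2_summable_finite_support:
  fixes x :: "nat \<Rightarrow> real"
  assumes "\<And>j. n \<le> j \<Longrightarrow> x j = 0"
  shows "summable (\<lambda>j. (x j)\<^sup>2)"
  by (rule summable_finite[of "{..<n}"]) (use assms in \<open>auto simp: not_less\<close>)

instantiation ell2 :: real_vector
begin

lift_definition zero_ell2 :: ell2 is "\<lambda>_. 0" by simp

lift_definition plus_ell2 :: "ell2 \<Rightarrow> ell2 \<Rightarrow> ell2" is "\<lambda>x y j. x j + y j"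
  by (rule ell2_summable_add)

lift_definition uminus_ell2 :: "ell2 \<Rightarrow> ell2" is "\<lambda>x j. - x j" by simp

lift_definition minus_ell2 :: "ell2 \<Rightarrow> ell2 \<Rightarrow> ell2" is "\<lambda>x y j. x j - y j"
  using ell2_summable_add[of _ "\<lambda>j. - _ j"] by simp

lift_definition scaleR_ell2 :: "real \<Rightarrow> ell2 \<Rightarrow> ell2" is "\<lambda>c x j. c * x j"
  by (rule ell2_summable_scale)

instance
  by standard (transfer; simp add: fun_eq_iff algebra_simps)+

end

instantiation ell2 :: real_inner
begin

lift_definition inner_ell2 :: "ell2 \<Rightarrow> ell2 \<Rightarrow> real" is "\<lambda>x y. \<Sum>j. x j * y j" .

definition norm_ell2 :: "ell2 \<Rightarrow> real" where "norm_ell2 x = sqrt (inner x x)"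

definition dist_ell2 :: "ell2 \<Rightarrow> ell2 \<Rightarrow> real" where "dist_ell2 x y = norm (x - y)"

definition sgn_ell2 :: "ell2 \<Rightarrow> ell2" where "sgn_ell2 x = x /\<^sub>R norm x"

definition uniformity_ell2 :: "(ell2 \<times> ell2) filter" where
  "uniformity_ell2 = (INF e\<in>{0 <..}. principal {(x, y). dist x y < e})"

definition open_ell2 :: "ell2 set \<Rightarrow> bool" where
  "open_ell2 U \<longleftrightarrow> (\<forall>x\<in>U. eventually (\<lambda>(x', y). x' = x \<longrightarrow> y \<in> U) uniformity)"

instance
proof
  fix x y z :: ell2 and r :: real and U :: "ell2 set"
  show "dist x y = norm (x - y)" by (rule dist_ell2_def)
  show "sgn x = x /\<^sub>R norm x" by (rule sgn_ell2_def)
  show "(uniformity :: (ell2 \<times> ell2) filter) = (INF e\<in>{0 <..}. principal {(x, y). dist x y < e})"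
    by (rule uniformity_ell2_def)
  show "open U \<longleftrightarrow> (\<forall>x\<in>U. eventually (\<lambda>(x', y). x' = x \<longrightarrow> y \<in> U) uniformity)"
    by (rule open_ell2_def)
  show "norm x = sqrt (inner x x)" by (rule norm_ell2_def)
  show "inner x y = inner y x" by transfer (simp add: mult.commute)
  show "inner (x + y) z = inner x z + inner y z"
    by transfer (simp add: algebra_simps suminf_add ell2_summable_prod)
  show "inner (r *\<^sub>R x) y = r * inner x y"
    by transfer (simp add: mult.assoc suminf_mult ell2_summable_prod)
  show "0 \<le> inner x x"
    by transfer (simp add: suminf_nonneg flip: power2_eq_square)
  show "inner x x = 0 \<longleftrightarrow> x = 0"
    by transfer (simp add: suminf_eq_zero_iff fun_eq_iff flip: power2_eq_square)
qed

end

text \<open>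
  Every finite-dimensional space sits inside \<open>ell2\<close> by zero padding; coordinates are counted from 0,
  so \<open>hilb d\<close> has the coordinates \<open>{j. enat j < d}\<close>.  In particular \<open>hilb \<infinity> = UNIV\<close>.
\<close>

definition hilb :: "enat \<Rightarrow> ell2 set" where
  "hilb d = {x. \<forall>j. d \<le> enat j \<longrightarrow> coord x j = 0}"

lift_definition basis_vec :: "nat \<Rightarrow> ell2" is "\<lambda>k j. if j = k then 1 else 0"
  subgoal for k by (rule ell2_summable_finite_support[of "Suc k"]) auto
  done

text \<open>
  The \<open>i\<close>-th component of \<open>x\<close> under the identification of \<open>hilb \<infinity>\<close> with the direct sum of the
  spaces \<open>hilb (enat (d i))\<close>.
\<close>

lift_definition block :: "(nat \<Rightarrow> nat) \<Rightarrow> nat \<Rightarrow> ell2 \<Rightarrow> ell2" is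
  "\<lambda>d i x j. if j < d i then x ((\<Sum>k<i. d k) + j) else 0"
  subgoal for d i x by (rule ell2_summable_finite_support[of "d i"]) auto
  done

lemma hilb_infinity: "hilb \<infinity> = UNIV"
  by (simp add: hilb_def)

lemma basis_vec_in_hilb: "basis_vec k \<in> hilb d \<longleftrightarrow> enat k < d"
  unfolding hilb_def mem_Collect_eq by transfer (auto simp: not_le[symmetric])

lemma block_in_hilb: "block d i x \<in> hilb (enat (d i))"
  unfolding hilb_def mem_Collect_eq by transfer auto

lemma zero_in_hilb: "0 \<in> hilb d"
  unfolding hilb_def mem_Collect_eq by transfer auto

section \<open>Derivatives of higher order\<close>

text \<open>
  Order-\<open>r\<close> tensors on \<open>hilb d\<close> are bounded \<open>r\<close>-linear forms, represented as functions on lists of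
  vectors; only their values on lists of length \<open>r\<close> over \<open>hilb d\<close> matter.
\<close>

definition bounded_multilinear_form :: "enat \<Rightarrow> nat \<Rightarrow> (ell2 list \<Rightarrow> real) \<Rightarrow> bool" where
  "bounded_multilinear_form d r T \<longleftrightarrow>
     (\<forall>us\<in>lists (hilb d). \<forall>vs\<in>lists (hilb d). length us + 1 + length vs = r \<longrightarrow>
        (\<forall>x\<in>hilb d. \<forall>y\<in>hilb d. \<forall>a b.
           T (us @ (a *\<^sub>R x + b *\<^sub>R y) # vs) = a * T (us @ x # vs) + b * T (us @ y # vs))) \<and>
     (\<exists>K. \<forall>vs\<in>lists (hilb d). length vs = r \<longrightarrow> \<bar>T vs\<bar> \<le> K * (\<Prod>v\<leftarrow>vs. norm v))"

text \<open>
  Frechet differentiability at \<open>x\<close> of a map \<open>G\<close> from \<open>hilb d\<close> into the order-\<open>r\<close> tensors, with respect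
  to the operator norm on tensors.  The derivative, a bounded linear map from \<open>hilb d\<close> into the
  order-\<open>r\<close> tensors, is uncurried to the order-\<open>(r + 1)\<close> tensor \<open>T\<close>, whose first argument is the new
  direction.
\<close>

definition has_tensor_derivative ::
    "enat \<Rightarrow> nat \<Rightarrow> (ell2 \<Rightarrow> ell2 list \<Rightarrow> real) \<Rightarrow> (ell2 list \<Rightarrow> real) \<Rightarrow> ell2 \<Rightarrow> bool" where
  "has_tensor_derivative d r G T x \<longleftrightarrow>
     bounded_multilinear_form d (Suc r) T \<and>
     (\<forall>e>0. \<exists>\<delta>>0. \<forall>h\<in>hilb d. norm h < \<delta> \<longrightarrow>
        (\<forall>vs\<in>lists (hilb d). length vs = r \<longrightarrow>
           \<bar>G (x + h) vs - G x vs - T (h # vs)\<bar> \<le> e * norm h * (\<Prod>v\<leftarrow>vs. norm v)))"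

text \<open>
  \<open>nabla d f r x\<close> is the tensor of order \<open>r\<close> of derivatives of \<open>f\<close> at \<open>x\<close>.  The choice is unique on
  lists of length \<open>r\<close> over \<open>hilb d\<close> as long as the derivative exists.
\<close>

primrec nabla :: "enat \<Rightarrow> (ell2 \<Rightarrow> real) \<Rightarrow> nat \<Rightarrow> ell2 \<Rightarrow> ell2 list \<Rightarrow> real" where
  "nabla d f 0 = (\<lambda>x _. f x)"
| "nabla d f (Suc r) = (\<lambda>x. SOME T. has_tensor_derivative d r (nabla d f r) T x)"

definition differentiable_through_order :: "enat \<Rightarrow> nat \<Rightarrow> (ell2 \<Rightarrow> real) \<Rightarrow> bool" where
  "differentiable_through_order d p f \<longleftrightarrow>
     (\<forall>r<p. \<forall>x\<in>hilb d. \<exists>T. has_tensor_derivative d r (nabla d f r) T x)"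

text \<open>On the whole space, the first-order notion is the Frechet derivative of the library.\<close>

lemma has_tensor_derivative_iff_has_derivative:
  "has_tensor_derivative \<infinity> 0 (\<lambda>x _. f x) T x \<longleftrightarrow> (f has_derivative (\<lambda>h. T [h])) (at x)"
proof -
  have lists_0: "(\<forall>vs\<in>lists UNIV. length vs = 0 \<longrightarrow> P vs) \<longleftrightarrow> P []" for P :: "ell2 list \<Rightarrow> bool"
    by auto
  have single: "(\<forall>vs\<in>lists UNIV. length vs = Suc 0 \<longrightarrow> P vs) \<longleftrightarrow> (\<forall>v. P [v])"
    for P :: "ell2 list \<Rightarrow> bool"
    by (auto simp: length_Suc_conv)
  have "bounded_multilinear_form \<infinity> (Suc 0) T \<longleftrightarrow>
      (\<forall>x y a b. T [a *\<^sub>R x + b *\<^sub>R y] = a * T [x] + b * T [y]) \<and>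
      (\<exists>K. \<forall>v. \<bar>T [v]\<bar> \<le> K * norm v)"
    unfolding bounded_multilinear_form_def hilb_infinity single
    by auto
  also have "\<dots> \<longleftrightarrow> bounded_linear (\<lambda>h. T [h])"
  proof (safe, goal_cases)
    case (1 K)
    show ?case
    proof (rule bounded_linear_intro)
      fix u v :: ell2 and c :: real
      show "T [u + v] = T [u] + T [v]" using 1(1)[rule_format, of 1 u 1 v] by simp
      show "T [c *\<^sub>R u] = c *\<^sub>R T [u]" using 1(1)[rule_format, of c u 0 u] by simp
      show "norm (T [u]) \<le> norm u * K" using 1(2)[rule_format, of u] by (simp add: mult.commute)
    qed
  next
    case (2 u v a b)
    then interpret bounded_linear "\<lambda>h. T [h]" .
    show ?case by (simp add: add scaleR)
  next
    case 3
    then show ?case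
      using bounded_linear.bounded by (fastforce simp: mult.commute)
  qed
  finally have bl: "bounded_multilinear_form \<infinity> (Suc 0) T \<longleftrightarrow> bounded_linear (\<lambda>h. T [h])" .
  have shift: "(\<forall>y. P y (y - x)) \<longleftrightarrow> (\<forall>h. P (x + h) h)" for P :: "ell2 \<Rightarrow> ell2 \<Rightarrow> bool"
    by (metis add_diff_cancel_left' add.commute diff_add_cancel)
  show ?thesis
    unfolding has_tensor_derivative_def has_derivative_at_alt hilb_infinity lists_0 bl
      shift[where P = "\<lambda>y h. norm h < _ \<longrightarrow> norm (f y - f x - T [h]) \<le> _ * norm h"]
    by simp
qed

section \<open>Zero-respecting sequences and algorithms\<close>

definition supp :: "ell2 \<Rightarrow> nat set" where
  "supp x = {j. coord x j \<noteq> 0}"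

definition supp_tensor :: "enat \<Rightarrow> nat \<Rightarrow> (ell2 list \<Rightarrow> real) \<Rightarrow> nat set" where
  "supp_tensor d r T =
     {j. enat j < d \<and>
         (\<exists>js. length js = r - 1 \<and> (\<forall>k\<in>set js. enat k < d) \<and> T (map basis_vec (j # js)) \<noteq> 0)}"

text \<open>Sequences of iterates are indexed from 1; the entry at index 0 plays no role.\<close>

definition zero_respecting :: "enat \<Rightarrow> nat \<Rightarrow> (ell2 \<Rightarrow> real) \<Rightarrow> (nat \<Rightarrow> ell2) \<Rightarrow> bool" where
  "zero_respecting d p f x \<longleftrightarrow>
     (\<forall>t\<ge>1. x t \<in> hilb d \<and>
        supp (x t) \<subseteq> (\<Union>r\<in>{1..p}. \<Union>s\<in>{1..<t}. supp_tensor d r (nabla d f r (x s))))"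

text \<open>
  A function on \<open>hilb d\<close> is an element of \<open>extensional (hilb d)\<close>.  Since it does not determine \<open>d\<close> as
  a HOL function, algorithms and error metrics receive \<open>d\<close> as a separate argument.
\<close>

type_synonym algorithm = "enat \<Rightarrow> (ell2 \<Rightarrow> real) \<Rightarrow> nat \<Rightarrow> ell2"

definition is_algorithm :: "algorithm \<Rightarrow> bool" where
  "is_algorithm A \<longleftrightarrow> (\<forall>d\<ge>1. \<forall>f\<in>extensional (hilb d). \<forall>t\<ge>1. A d f t \<in> hilb d)"

definition zr_algorithms :: "nat \<Rightarrow> algorithm set" where
  "zr_algorithms p =
     {A. is_algorithm A \<and>
         (\<forall>d\<ge>1. \<forall>f\<in>extensional (hilb d).
            differentiable_through_order d p f \<longrightarrow> zero_respecting d p f (A d f))}"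

text \<open>The infimum over this class is thus never taken over the empty set.\<close>

lemma zr_algorithms_nonempty: "(\<lambda>_ _ _. 0) \<in> zr_algorithms p"
proof -
  have "supp 0 = {}" unfolding supp_def by transfer simp
  then show ?thesis
    by (simp add: zr_algorithms_def is_algorithm_def zero_respecting_def zero_in_hilb)
qed

section \<open>Function classes and error metrics\<close>

type_synonym function_family = "enat \<Rightarrow> (ell2 \<Rightarrow> real) set"
type_synonym error_metric = "enat \<Rightarrow> ell2 \<Rightarrow> (ell2 \<Rightarrow> real) \<Rightarrow> real"

definition is_function_family :: "nat \<Rightarrow> function_family \<Rightarrow> bool" where
  "is_function_family p \<F> \<longleftrightarrow>
     (\<forall>d\<ge>1. \<forall>f\<in>\<F> d. f \<in> extensional (hilb d) \<and> differentiable_through_order d p f)"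

definition is_error_metric :: "function_family \<Rightarrow> error_metric \<Rightarrow> bool" where
  "is_error_metric \<F> \<epsilon> \<longleftrightarrow> (\<forall>d\<ge>1. \<forall>f\<in>\<F> d. \<forall>x\<in>hilb d. 0 \<le> \<epsilon> d x f)"

definition error_after :: "error_metric \<Rightarrow> enat \<Rightarrow> nat \<Rightarrow> algorithm \<Rightarrow> (ell2 \<Rightarrow> real) \<Rightarrow> real" where
  "error_after \<epsilon> d n A f = \<epsilon> d (A d f (n + 1)) f"

definition decreasing_bijection :: "(real \<Rightarrow> real) \<Rightarrow> bool" where
  "decreasing_bijection \<beta> \<longleftrightarrow> bij_betw \<beta> {1..} {0<..1} \<and> antimono_on {1..} \<beta>"

text \<open>Sequences indexed by the positive integers other than iterates are indexed from 0 here.\<close>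

definition direct_sum :: "(nat \<Rightarrow> real) \<Rightarrow> (nat \<Rightarrow> real) \<Rightarrow> (nat \<Rightarrow> nat) \<Rightarrow>
    (nat \<Rightarrow> ell2 \<Rightarrow> real) \<Rightarrow> ell2 \<Rightarrow> real" where
  "direct_sum lam \<mu> d f x = (\<Sum>i. lam i * f i (\<mu> i *\<^sub>R block d i x))"

text \<open>
  That the direct sum is a function on \<open>hilb \<infinity>\<close> includes convergence of the series, which has to be
  stated separately because \<open>suminf\<close> is total.
\<close>

definition direct_sum_assumption :: "function_family \<Rightarrow> error_metric \<Rightarrow> bool" where
  "direct_sum_assumption \<F> \<epsilon> \<longleftrightarrow>
     (\<exists>(q :: nat) lam \<mu>. (\<forall>i. 0 < lam i) \<and> (\<forall>i. 0 < \<mu> i) \<and>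
        (\<forall>(d :: nat \<Rightarrow> nat) f. (\<forall>i. 0 < d i) \<and> (\<forall>i. f i \<in> \<F> (enat (d i))) \<longrightarrow>
           (\<forall>x\<in>hilb \<infinity>. summable (\<lambda>i. lam i * f i (\<mu> i *\<^sub>R block d i x))) \<and>
           direct_sum lam \<mu> d f \<in> \<F> \<infinity> \<and>
           (\<forall>i. \<forall>x\<in>hilb \<infinity>.
              \<epsilon> \<infinity> x (direct_sum lam \<mu> d f)
                \<ge> lam i * \<mu> i ^ q * \<epsilon> (enat (d i)) (\<mu> i *\<^sub>R block d i x) (f i))))"

definition nonasymptotic_lower_bound ::
    "nat \<Rightarrow> function_family \<Rightarrow> error_metric \<Rightarrow> (real \<Rightarrow> real) \<Rightarrow> bool" where
  "nonasymptotic_lower_bound p \<F> \<epsilon> \<beta> \<longleftrightarrow>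
     decreasing_bijection \<beta> \<and>
     (\<exists>C>0. \<forall>n\<ge>1. \<exists>d::nat. 1 \<le> d \<and> (\<exists>f\<in>\<F> (enat d).
        \<forall>x. zero_respecting (enat d) p f x \<and> x 1 = 0 \<longrightarrow>
          \<epsilon> (enat d) (x (n + 1)) f \<ge> C * \<beta> (real n)))"

end

(* Choose n i so large that rho (n i) is at most C * lam i * mu i ^ q, and let F be the direct sum of
   the hard instances f i for the iteration counts n i.  Since each block of coordinates enters only
   one summand, a derivative tensor of F has nonzero entries only when all its indices lie in the same
   block, where it is a rescaled derivative tensor of f i.  Hence the blocks of a sequence that is
   zero-respecting for F are, after rescaling, zero-respecting for every f i at once, and the lower
   bounds for all the f i carry over to F. *)

theory Submission
  imports Defs
begin

section \<open>Directional derivatives of tensor fields\<close>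

text \<open>Restricting the Frechet estimate to a line through \<open>x\<close>, with
  \<open>vs\<close> fixed, leaves a real function of one variable. Entries of derivative tensors
  then become accessible to the chain rule and to uniqueness of real derivatives.\<close>

lemma has_tensor_derivative_directional:
  assumes T: "has_tensor_derivative d r G T x"
    and h: "h \<in> hilb d" and vs: "vs \<in> lists (hilb d)" "length vs = r"
  shows "((\<lambda>t. G (x + t *\<^sub>R h) vs) has_real_derivative T (h # vs)) (at 0)"
proof -
  define M where "M = norm h * (\<Prod>v\<leftarrow>vs. norm v)"
  have M0: "0 \<le> M"
    unfolding M_def by (intro mult_nonneg_nonneg prod_list_nonneg) auto
  have scaled: "t *\<^sub>R h \<in> hilb d" for t
    using h by (simp add: hilb_def scaleR_ell2.rep_eq)
  have homogeneous: "T ((t *\<^sub>R h) # vs) = t * T (h # vs)" for t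
  proof -
    \<comment> \<open>The second vector gets coefficient 0, so multilinearity in the first slot
      reduces to homogeneity.\<close>
    have "T ([] @ (t *\<^sub>R h + 0 *\<^sub>R h) # vs) = t * T ([] @ h # vs) + 0 * T ([] @ h # vs)"
      using T[unfolded has_tensor_derivative_def bounded_multilinear_form_def, THEN conjunct1,
          THEN conjunct1, rule_format, of "[]" vs h h t 0] h vs by simp
    then show ?thesis by simp
  qed
  have "((\<lambda>t. G (x + t *\<^sub>R h) vs) has_derivative (\<lambda>t. t * T (h # vs))) (at 0)"
    unfolding has_derivative_at_alt
  proof (intro conjI allI impI)
    show "bounded_linear (\<lambda>t. t * T (h # vs))" by (rule bounded_linear_mult_left)
    fix e :: real
    assume "e > 0"
    \<comment> \<open>Adding 1 to \<open>M\<close> avoids division by zero when \<open>h\<close> or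
      some entry of \<open>vs\<close> vanishes; \<open>norm h + 1\<close> serves the same purpose
      below.\<close>
    define e' where "e' = e / (M + 1)"
    have e': "e' > 0" "e' * M \<le> e"
      using \<open>e > 0\<close> M0 by (auto simp: e'_def field_simps)
    obtain \<delta> where \<delta>: "\<delta> > 0" and bound: "\<And>k. k \<in> hilb d \<Longrightarrow> norm k < \<delta> \<Longrightarrow>
        \<bar>G (x + k) vs - G x vs - T (k # vs)\<bar> \<le> e' * norm k * (\<Prod>v\<leftarrow>vs. norm v)"
      using T[unfolded has_tensor_derivative_def, THEN conjunct2, rule_format, OF e'(1)] vs by blast
    show "\<exists>\<delta>>0. \<forall>t. norm (t - 0) < \<delta> \<longrightarrow>
        norm (G (x + t *\<^sub>R h) vs - G (x + 0 *\<^sub>R h) vs - (t - 0) * T (h # vs)) \<le> e * norm (t - 0)"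
    proof (intro exI[of _ "\<delta> / (norm h + 1)"] conjI allI impI)
      show "\<delta> / (norm h + 1) > 0" using \<delta> by (simp add: add_nonneg_pos)
      fix t :: real
      assume "norm (t - 0) < \<delta> / (norm h + 1)"
      then have "\<bar>t\<bar> * (norm h + 1) < \<delta>"
        by (simp add: pos_less_divide_eq add_nonneg_pos)
      then have "norm (t *\<^sub>R h) < \<delta>" by (simp add: algebra_simps)
      from bound[OF scaled this]
      have "\<bar>G (x + t *\<^sub>R h) vs - G x vs - t * T (h # vs)\<bar> \<le> (e' * M) * \<bar>t\<bar>"
        by (simp add: homogeneous M_def mult_ac)
      also have "\<dots> \<le> e * \<bar>t\<bar>" by (intro mult_right_mono e') auto
      finally show "norm (G (x + t *\<^sub>R h) vs - G (x + 0 *\<^sub>R h) vs - (t - 0) * T (h # vs))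
          \<le> e * norm (t - 0)" by simp
    qed
  qed
  then show ?thesis
    by (rule has_derivative_imp_has_field_derivative) (rule refl)
qed

text \<open>For \<open>r < p\<close> a derivative exists, so the choice made by \<open>SOME\<close>
  in \<open>nabla\<close> is a genuine derivative.\<close>

lemma nabla_directional:
  assumes "differentiable_through_order d p f" "r < p" "x \<in> hilb d"
    and "h \<in> hilb d" "vs \<in> lists (hilb d)" "length vs = r"
  shows "((\<lambda>t. nabla d f r (x + t *\<^sub>R h) vs) has_real_derivative nabla d f (Suc r) x (h # vs)) (at 0)"
proof (rule has_tensor_derivative_directional[where d = d])
  show "has_tensor_derivative d r (nabla d f r) (nabla d f (Suc r) x) x"
    unfolding nabla.simps
    by (rule someI_ex[where P = "\<lambda>T. has_tensor_derivative d r (nabla d f r) T x"])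
      (use assms(1-3) in \<open>simp add: differentiable_through_order_def\<close>)
qed (use assms in auto)

section \<open>The blocks of a direct sum\<close>

abbreviation offset :: "(nat \<Rightarrow> nat) \<Rightarrow> nat \<Rightarrow> nat" where
  "offset d i \<equiv> (\<Sum>k<i. d k)"

lemma offset_le:
  fixes d :: "nat \<Rightarrow> nat"
  assumes "i < k"
  shows "offset d i + d i \<le> offset d k"
  using sum_mono2[of "{..<k}" "{..<Suc i}" d] assms by auto

lemma offset_unique:
  fixes d :: "nat \<Rightarrow> nat"
  assumes "offset d i + a = offset d k + b" "a < d i" "b < d k"
  shows "i = k \<and> a = b"
  using assms offset_le[of i k d] offset_le[of k i d] by (cases i k rule: linorder_cases) auto

text \<open>Together with \<open>offset_unique\<close> this assigns every coordinate to exactly one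
  block and position.\<close>

lemma offset_exists:
  fixes d :: "nat \<Rightarrow> nat"
  assumes "\<And>i. 0 < d i"
  obtains i a where "j = offset d i + a" "a < d i"
proof -
  have "\<exists>i a. j = offset d i + a \<and> a < d i"
  proof (induction j)
    case 0
    show ?case using assms by (intro exI[of _ 0]) auto
  next
    case (Suc j)
    then obtain i a where ia: "j = offset d i + a" "a < d i" by blast
    show ?case
    proof (cases "Suc a < d i")
      case True
      then show ?thesis using ia by (intro exI[of _ i] exI[of _ "Suc a"]) auto
    next
      case False
      \<comment> \<open>The current block is exhausted; the next one has a position 0 because all
        blocks are nonempty.\<close>
      then show ?thesis using ia assms by (intro exI[of _ "Suc i"] exI[of _ 0]) auto
    qed
  qed
  then show ?thesis using that by blast
qed

lemma coord_block: "coord (block d i x) j = (if j < d i then coord x (offset d i + j) else 0)"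
  by (rule block.rep_eq[THEN fun_cong])

text \<open>This is the decoupling on which everything rests: blocks are disjoint, so moving one
  coordinate moves a single block.\<close>

lemma block_add_basis_vec:
  assumes "a < d i"
  shows "block d k (x + t *\<^sub>R basis_vec (offset d i + a)) =
    block d k x + (if k = i then t *\<^sub>R basis_vec a else 0)"
proof -
  have "coord (block d k (x + t *\<^sub>R basis_vec (offset d i + a))) j =
      coord (block d k x + (if k = i then t *\<^sub>R basis_vec a else 0)) j" for j
    using assms offset_unique[of d i a k j]
    by (auto simp: coord_block plus_ell2.rep_eq scaleR_ell2.rep_eq basis_vec.rep_eq zero_ell2.rep_eq)
  then show ?thesis by (auto simp flip: coord_inject)
qed

lemma scaleR_in_hilb: "x \<in> hilb d \<Longrightarrow> c *\<^sub>R x \<in> hilb d"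
  by (simp add: hilb_def scaleR_ell2.rep_eq)

section \<open>Derivative tensors of a direct sum and their supports\<close>

locale differentiable_direct_sum =
  fixes p :: nat and d :: "nat \<Rightarrow> nat" and f :: "nat \<Rightarrow> ell2 \<Rightarrow> real" and lam \<mu> :: "nat \<Rightarrow> real"
  assumes d_pos: "\<And>i. 0 < d i"
    and \<mu>_pos: "\<And>i. 0 < \<mu> i"
    and summable: "\<And>x. summable (\<lambda>i. lam i * f i (\<mu> i *\<^sub>R block d i x))"
    and diff_f: "\<And>i. differentiable_through_order (enat (d i)) p (f i)"
    and diff_F: "differentiable_through_order \<infinity> p (direct_sum lam \<mu> d f)"
begin

abbreviation F :: "ell2 \<Rightarrow> real" where
  "F \<equiv> direct_sum lam \<mu> d f"

abbreviation comp :: "nat \<Rightarrow> ell2 \<Rightarrow> ell2" where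
  "comp i x \<equiv> \<mu> i *\<^sub>R block d i x"

lemma comp_in_hilb: "comp i x \<in> hilb (enat (d i))"
  by (intro scaleR_in_hilb block_in_hilb)

text \<open>All summands except the \<open>i\<close>-th cancel in the difference. Derivatives along
  coordinates can therefore be computed without interchanging a limit with the infinite sum.\<close>

lemma direct_sum_add_basis_vec:
  assumes "a < d i"
  shows "F (x + t *\<^sub>R basis_vec (offset d i + a)) - F x =
    lam i * (f i (comp i x + (\<mu> i * t) *\<^sub>R basis_vec a) - f i (comp i x))"
proof -
  let ?x' = "x + t *\<^sub>R basis_vec (offset d i + a)"
  have "F ?x' - F x = (\<Sum>k. lam k * f k (comp k ?x') - lam k * f k (comp k x))"
    unfolding direct_sum_def by (rule suminf_diff[OF summable summable])
  also have "\<dots> = (\<Sum>k\<in>{i}. lam k * f k (comp k ?x') - lam k * f k (comp k x))"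
    by (rule suminf_finite) (use assms in \<open>auto simp: block_add_basis_vec\<close>)
  also have "\<dots> = lam i * (f i (comp i x + (\<mu> i * t) *\<^sub>R basis_vec a) - f i (comp i x))"
    using assms by (simp add: block_add_basis_vec scaleR_add_right right_diff_distrib)
  finally show ?thesis .
qed

text \<open>The chain rule for \<open>\<mu> i * t\<close> contributes one factor
  \<open>\<mu> i\<close> per differentiation, whence the power in
  \<open>nabla_direct_sum\<close>.\<close>

lemma nabla_comp_directional:
  assumes "r < p" "a < d i" "set ks \<subseteq> {..<d i}" "length ks = r"
  shows "((\<lambda>t. nabla (enat (d i)) (f i) r (comp i x + (\<mu> i * t) *\<^sub>R basis_vec a) (map basis_vec ks))
     has_real_derivative \<mu> i * nabla (enat (d i)) (f i) (Suc r) (comp i x) (map basis_vec (a # ks)))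
     (at 0)"
proof -
  have "((\<lambda>t. nabla (enat (d i)) (f i) r (comp i x + t *\<^sub>R basis_vec a) (map basis_vec ks))
     has_real_derivative nabla (enat (d i)) (f i) (Suc r) (comp i x) (basis_vec a # map basis_vec ks))
     (at (\<mu> i * 0))"
    unfolding mult_zero_right
    by (rule nabla_directional[OF diff_f assms(1) comp_in_hilb])
      (use assms in \<open>auto simp: basis_vec_in_hilb subset_eq\<close>)
  from DERIV_chain2[OF this DERIV_cmult_Id]
  show ?thesis by (simp add: mult.commute)
qed

lemma nabla_direct_sum_directional:
  assumes "r < p" "length js = r"
  shows "((\<lambda>t. nabla \<infinity> F r (x + t *\<^sub>R basis_vec j) (map basis_vec js))
    has_real_derivative nabla \<infinity> F (Suc r) x (map basis_vec (j # js))) (at 0)"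
  unfolding list.map
  by (rule nabla_directional[OF diff_F assms(1)]) (use assms in \<open>auto simp: hilb_infinity\<close>)

text \<open>
  The recursion peels off the direction that is differentiated last, so the statement has to hold
  for all \<open>x\<close> at once, and no symmetry of the derivatives is needed.
\<close>

lemma nabla_direct_sum:
  assumes "1 \<le> r" "r \<le> p" "length js = r"
  shows "(\<exists>i ks. js = map ((+) (offset d i)) ks \<and> set ks \<subseteq> {..<d i} \<and>
      (\<forall>x. nabla \<infinity> F r x (map basis_vec js) =
        lam i * \<mu> i ^ r * nabla (enat (d i)) (f i) r (comp i x) (map basis_vec ks))) \<or>
    (\<forall>x. nabla \<infinity> F r x (map basis_vec js) = 0)"
  using assms
proof (induction r arbitrary: js rule: nat_induct_at_least)
  case base
  then obtain j where js: "js = [j]" by (auto simp: length_Suc_conv)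
  obtain i a where ia: "j = offset d i + a" "a < d i" using offset_exists d_pos by blast
  have "nabla \<infinity> F 1 x [basis_vec j] =
      lam i * \<mu> i ^ 1 * nabla (enat (d i)) (f i) 1 (comp i x) [basis_vec a]" for x
  proof -
    \<comment> \<open>The value of \<open>F\<close> itself involves every block, so the induction
      starts at order 1, and subtracting the constant \<open>F x\<close> isolates block
      \<open>i\<close>.\<close>
    have "((\<lambda>t. lam i * (f i (comp i x + (\<mu> i * t) *\<^sub>R basis_vec a) - f i (comp i x)))
        has_real_derivative lam i * (\<mu> i * nabla (enat (d i)) (f i) 1 (comp i x) [basis_vec a] - 0))
        (at 0)"
      using nabla_comp_directional[of 0 a i "[]" x] base ia
      by (intro DERIV_cmult DERIV_diff DERIV_const) auto
    then have "((\<lambda>t. F (x + t *\<^sub>R basis_vec j) - F x) has_real_derivative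
        lam i * \<mu> i * nabla (enat (d i)) (f i) 1 (comp i x) [basis_vec a]) (at 0)"
      using ia by (simp add: direct_sum_add_basis_vec mult.assoc del: nabla.simps)
    moreover have "((\<lambda>t. F (x + t *\<^sub>R basis_vec j) - F x)
        has_real_derivative nabla \<infinity> F 1 x [basis_vec j] - 0) (at 0)"
      using nabla_direct_sum_directional[of 0 "[]" x j] base
      by (intro DERIV_diff DERIV_const) auto
    ultimately show ?thesis
      using DERIV_unique by (fastforce simp del: nabla.simps)
  qed
  then show ?case
    using js ia by (intro disjI1 exI[of _ i] exI[of _ "[a]"]) (simp del: nabla.simps)
next
  case (Suc r)
  then obtain j js' where js: "js = j # js'" "length js' = r" by (auto simp: length_Suc_conv)
  have r: "r < p" "r \<le> p" using Suc.prems by auto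
  note deriv = nabla_direct_sum_directional[OF r(1) js(2), of _ j]
  \<comment> \<open>An order-\<open>r\<close> entry that is constant along direction
    \<open>j\<close> has zero derivative there. This covers both an identically zero entry and a
    direction \<open>j\<close> outside its block.\<close>
  have vanish: ?case if "\<And>x t. nabla \<infinity> F r (x + t *\<^sub>R basis_vec j) (map basis_vec js') =
      nabla \<infinity> F r x (map basis_vec js')"
  proof (intro disjI2 allI)
    fix x
    show "nabla \<infinity> F (Suc r) x (map basis_vec js) = 0"
      using deriv[of x] unfolding that js(1) by (rule DERIV_unique) (rule DERIV_const)
  qed
  from Suc.IH[OF r(2) js(2)] show ?case
  proof (elim disjE exE conjE)
    assume "\<forall>x. nabla \<infinity> F r x (map basis_vec js') = 0"
    then show ?case by (intro vanish) (simp del: nabla.simps)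
  next
    fix i ks
    assume ks: "js' = map ((+) (offset d i)) ks" "set ks \<subseteq> {..<d i}"
      and eq: "\<forall>x. nabla \<infinity> F r x (map basis_vec js') =
        lam i * \<mu> i ^ r * nabla (enat (d i)) (f i) r (comp i x) (map basis_vec ks)"
    obtain k a where ka: "j = offset d k + a" "a < d k" using offset_exists d_pos by blast
    show ?case
    proof (cases "k = i")
      \<comment> \<open>The entry depends on \<open>x\<close> only through block \<open>i\<close>,
        which a move inside block \<open>k\<close> leaves fixed.\<close>
      case False
      then show ?thesis
        using ka by (intro vanish) (simp add: eq block_add_basis_vec del: nabla.simps)
    next
      case True
      have a: "a < d i" and len: "length ks = r" using ka True ks js by auto
      have "nabla \<infinity> F (Suc r) x (map basis_vec js) =
          lam i * \<mu> i ^ Suc r * nabla (enat (d i)) (f i) (Suc r) (comp i x) (map basis_vec (a # ks))"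
        for x
      proof -
        have "nabla \<infinity> F r (x + t *\<^sub>R basis_vec j) (map basis_vec js') =
            lam i * \<mu> i ^ r * nabla (enat (d i)) (f i) r
              (comp i x + (\<mu> i * t) *\<^sub>R basis_vec a) (map basis_vec ks)" for t
          using True ka by (simp add: eq block_add_basis_vec scaleR_add_right del: nabla.simps)
        \<comment> \<open>The same function of \<open>t\<close> is differentiated twice: as an entry
          of \<open>nabla \<infinity> F r\<close>, and through the induction hypothesis.\<close>
        note DERIV_unique[OF deriv[of x, unfolded this]
            DERIV_cmult[OF nabla_comp_directional[OF r(1) a ks(2) len]]]
        then show ?thesis by (simp add: js(1) mult_ac del: nabla.simps)
      qed
      then show ?thesis
        using js ks ka True by (intro disjI1 exI[of _ i] exI[of _ "a # ks"]) (simp del: nabla.simps)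
    qed
  qed
qed

text \<open>A coordinate of block \<open>i\<close> enters the support only through a nonzero entry
  of a derivative of \<open>F\<close>. Its first index lies in block \<open>i\<close>, so all its
  indices do, and the entry is a multiple of one of \<open>f i\<close> at the same earlier
  iterate.\<close>

lemma zero_respecting_comp:
  assumes "zero_respecting \<infinity> p F x"
  shows "zero_respecting (enat (d i)) p (f i) (\<lambda>t. comp i (x t))"
  unfolding zero_respecting_def
proof (intro allI impI conjI subsetI)
  fix t :: nat
  assume "t \<ge> 1"
  show "comp i (x t) \<in> hilb (enat (d i))" by (rule comp_in_hilb)
  fix a
  assume "a \<in> supp (comp i (x t))"
  then have a: "a < d i" and "offset d i + a \<in> supp (x t)"
    by (auto simp: supp_def scaleR_ell2.rep_eq coord_block split: if_splits)
  with assms \<open>t \<ge> 1\<close> obtain r s where r: "r \<in> {1..p}" and s: "s \<in> {1..<t}"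
    and "offset d i + a \<in> supp_tensor \<infinity> r (nabla \<infinity> F r (x s))"
    unfolding zero_respecting_def by blast
  then obtain js where js: "length js = r - 1"
    and nz: "nabla \<infinity> F r (x s) (map basis_vec ((offset d i + a) # js)) \<noteq> 0"
    unfolding supp_tensor_def by blast
  from r js have "1 \<le> r" "r \<le> p" "length ((offset d i + a) # js) = r" by auto
  from nabla_direct_sum[OF this] nz
  obtain k ks where ks: "(offset d i + a) # js = map ((+) (offset d k)) ks" "set ks \<subseteq> {..<d k}"
    and eq: "nabla \<infinity> F r (x s) (map basis_vec ((offset d i + a) # js)) =
      lam k * \<mu> k ^ r * nabla (enat (d k)) (f k) r (comp k (x s)) (map basis_vec ks)"
    by (elim disjE exE conjE) (rule that, assumption, assumption, erule spec, blast)
  from ks obtain b ks' where b: "ks = b # ks'" by (cases ks) auto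
  \<comment> \<open>The first index determines the block, which identifies the unknown block
    \<open>k\<close> with \<open>i\<close>.\<close>
  with ks a offset_unique[of d i a k b] have "k = i" "b = a" by auto
  with b ks eq nz js have "length ks' = r - 1" "set ks' \<subseteq> {..<d i}"
    "nabla (enat (d i)) (f i) r (comp i (x s)) (map basis_vec (a # ks')) \<noteq> 0"
    by auto
  with a have "a \<in> supp_tensor (enat (d i)) r (nabla (enat (d i)) (f i) r (comp i (x s)))"
    unfolding supp_tensor_def by auto
  with r s show "a \<in> (\<Union>r\<in>{1..p}. \<Union>s\<in>{1..<t}.
      supp_tensor (enat (d i)) r (nabla (enat (d i)) (f i) r (comp i (x s))))" by blast
qed

end

section \<open>The lower bound\<close>

text \<open>For \<open>t = 1\<close> there are no earlier iterates, so the union bounding the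
  support is empty.\<close>

lemma zero_respecting_first:
  assumes "zero_respecting d p f x"
  shows "x 1 = 0"
proof -
  have "supp (x 1) = {}" using assms unfolding zero_respecting_def by force
  then have "coord (x 1) = coord 0" by (auto simp: supp_def zero_ell2.rep_eq)
  then show ?thesis by (simp add: coord_inject)
qed

lemma decreasing_bijection_small:
  assumes "decreasing_bijection \<rho>" "0 < c"
  obtains n :: nat where "N \<le> n" "1 \<le> n" "\<rho> (real n) \<le> c"
proof -
  have bij: "\<rho> ` {1..} = {0<..1}" and anti: "antimono_on {1..} \<rho>"
    using assms(1) by (auto simp: decreasing_bijection_def bij_betw_def)
  \<comment> \<open>Truncation at 1 keeps the target value in the range of \<open>\<rho>\<close>,
    since \<open>c\<close> may exceed 1.\<close>
  have "min c 1 \<in> \<rho> ` {1..}" unfolding bij using assms(2) by auto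
  then obtain s where s: "1 \<le> s" "\<rho> s = min c 1" by auto
  define n where "n = max N (nat \<lceil>s\<rceil>)"
  have "s \<le> real n" unfolding n_def by linarith
  then have "\<rho> (real n) \<le> \<rho> s" using s by (intro monotone_onD[OF anti]) auto
  moreover have "1 \<le> n" using \<open>s \<le> real n\<close> s by linarith
  ultimately show ?thesis using that[of n] s by (auto simp: n_def)
qed

theorem theorem1:
  fixes \<F> :: function_family and \<epsilon> :: error_metric and p :: nat and \<beta> \<rho> :: "real \<Rightarrow> real"
  assumes "p \<ge> 1"
    and "is_function_family p \<F>"
    and "is_error_metric \<F> \<epsilon>"
    and "direct_sum_assumption \<F> \<epsilon>"
    and "nonasymptotic_lower_bound p \<F> \<epsilon> \<beta>"
    and "decreasing_bijection \<rho>"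
  shows "\<exists>F\<in>\<F> \<infinity>. \<exists>n :: nat \<Rightarrow> nat.
           (\<forall>i. n i > 0) \<and> filterlim n at_top sequentially \<and>
           (\<forall>i. (INF A\<in>zr_algorithms p. error_after \<epsilon> \<infinity> (n i) A F)
                  \<ge> \<rho> (real (n i)) * \<beta> (real (n i)))"
proof -
  obtain q :: nat and lam \<mu> where lam: "\<forall>i. 0 < lam i" and \<mu>: "\<forall>i. 0 < \<mu> i"
    and direct: "\<forall>(d :: nat \<Rightarrow> nat) f. (\<forall>i. 0 < d i) \<and> (\<forall>i. f i \<in> \<F> (enat (d i))) \<longrightarrow>
       (\<forall>x\<in>UNIV. summable (\<lambda>i. lam i * f i (\<mu> i *\<^sub>R block d i x))) \<and>
       direct_sum lam \<mu> d f \<in> \<F> \<infinity> \<and>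
       (\<forall>i. \<forall>x\<in>UNIV. \<epsilon> \<infinity> x (direct_sum lam \<mu> d f)
            \<ge> lam i * \<mu> i ^ q * \<epsilon> (enat (d i)) (\<mu> i *\<^sub>R block d i x) (f i))"
    using assms(4) unfolding direct_sum_assumption_def hilb_infinity
    by (elim exE conjE) (rule that)
  obtain C where C: "0 < C" and hard: "\<forall>n\<ge>1. \<exists>d::nat. 1 \<le> d \<and> (\<exists>f\<in>\<F> (enat d).
      \<forall>x. zero_respecting (enat d) p f x \<and> x 1 = 0 \<longrightarrow> \<epsilon> (enat d) (x (n + 1)) f \<ge> C * \<beta> (real n))"
    using assms(5) unfolding nonasymptotic_lower_bound_def by (elim exE conjE) (rule that)
  have \<beta>: "decreasing_bijection \<beta>"
    using assms(5) unfolding nonasymptotic_lower_bound_def by blast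
  \<comment> \<open>The bound \<open>i \<le> n\<close> yields divergence, \<open>1 \<le> n\<close>
    admits the hard instance, and the last condition lets \<open>\<rho>\<close> absorb the constant
    \<open>C\<close> and the loss factor of block \<open>i\<close>.\<close>
  have "\<exists>n. i \<le> n \<and> 1 \<le> n \<and> \<rho> (real n) \<le> lam i * \<mu> i ^ q * C" for i
  proof -
    have "0 < lam i * \<mu> i ^ q * C" using lam \<mu> C by simp
    from decreasing_bijection_small[OF assms(6) this, of i] show ?thesis by blast
  qed
  then obtain n where n: "\<And>i. i \<le> n i" "\<And>i. 1 \<le> n i"
    and \<rho>: "\<And>i. \<rho> (real (n i)) \<le> lam i * \<mu> i ^ q * C" by metis
  have "\<exists>d f. 1 \<le> d \<and> f \<in> \<F> (enat d) \<and> (\<forall>x. zero_respecting (enat d) p f x \<and> x 1 = 0 \<longrightarrow>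
      \<epsilon> (enat d) (x (n i + 1)) f \<ge> C * \<beta> (real (n i)))" for i
    using hard n(2)[of i] by blast
  then obtain d f where d: "\<And>i. 1 \<le> d i" and f: "\<And>i. f i \<in> \<F> (enat (d i))"
    and lower: "\<And>i x. zero_respecting (enat (d i)) p (f i) x \<Longrightarrow> x 1 = 0 \<Longrightarrow>
      \<epsilon> (enat (d i)) (x (n i + 1)) (f i) \<ge> C * \<beta> (real (n i))"
    by metis
  define F where "F = direct_sum lam \<mu> d f"
  have d_pos: "0 < d i" for i using d[of i] by simp
  have F_in: "F \<in> \<F> \<infinity>" and summable: "\<And>x. summable (\<lambda>i. lam i * f i (\<mu> i *\<^sub>R block d i x))"
    and transfer: "\<And>i x. lam i * \<mu> i ^ q * \<epsilon> (enat (d i)) (\<mu> i *\<^sub>R block d i x) (f i) \<le> \<epsilon> \<infinity> x F"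
    using direct d_pos f by (auto simp: F_def)
  have F_props: "F \<in> extensional (hilb \<infinity>)" "differentiable_through_order \<infinity> p F"
    using assms(2) F_in by (auto simp: is_function_family_def)
  have diff_f: "differentiable_through_order (enat (d i)) p (f i)" for i
    using assms(2) f[of i] d[of i] by (auto simp: is_function_family_def one_enat_def)
  interpret differentiable_direct_sum p d f lam \<mu>
    using d_pos \<mu> summable diff_f F_props(2) by unfold_locales (auto simp: F_def)
  have "\<rho> (real (n i)) * \<beta> (real (n i)) \<le> error_after \<epsilon> \<infinity> (n i) A F"
    if A: "A \<in> zr_algorithms p" for A i
  proof -
    define x where "x = A \<infinity> F"
    have x: "zero_respecting \<infinity> p F x"
      using A F_props by (auto simp: zr_algorithms_def x_def)
    have y: "zero_respecting (enat (d i)) p (f i) (\<lambda>t. \<mu> i *\<^sub>R block d i (x t))"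
      using x unfolding F_def by (rule zero_respecting_comp)
    have "0 < \<beta> (real (n i))"
      using \<beta> n(2)[of i] by (auto simp: decreasing_bijection_def bij_betw_def)
    then have "\<rho> (real (n i)) * \<beta> (real (n i)) \<le> lam i * \<mu> i ^ q * C * \<beta> (real (n i))"
      using \<rho> by (intro mult_right_mono) auto
    also have "\<dots> = lam i * \<mu> i ^ q * (C * \<beta> (real (n i)))" by simp
    also have "\<dots> \<le> lam i * \<mu> i ^ q * \<epsilon> (enat (d i)) (\<mu> i *\<^sub>R block d i (x (n i + 1))) (f i)"
      \<comment> \<open>The rescaled block sequence starts at 0 automatically, because it is itself
        zero-respecting.\<close>
      using lower[OF y zero_respecting_first[OF y]] lam \<mu> by (intro mult_left_mono) (auto simp: less_imp_le)
    also have "\<dots> \<le> \<epsilon> \<infinity> (x (n i + 1)) F" by (rule transfer)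
    finally show ?thesis by (simp add: error_after_def x_def)
  qed
  then have "\<rho> (real (n i)) * \<beta> (real (n i)) \<le> (INF A\<in>zr_algorithms p. error_after \<epsilon> \<infinity> (n i) A F)" for i
    \<comment> \<open>A lower bound for all members passes to the real infimum only over a nonempty
      set.\<close>
    using zr_algorithms_nonempty by (intro cINF_greatest) auto
  moreover have "filterlim n at_top sequentially"
    by (rule filterlim_at_top_mono[OF filterlim_ident]) (use n in auto)
  moreover have "n i > 0" for i using n(2)[of i] by simp
  ultimately show ?thesis using F_in by blast
qed

end
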